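(* Let $G$ be a group generated by a set $A$, and let $m\ge 0$ be an integer. If there exists an unbounded quasimorphism $f:G\to\mathbb{R}$ that is bounded above on the set of palindromes over $A$ (i.e. there is a constant $c$ with $f(p)\le c$ for all $p\in\mathcal{P}_0(A)$), then $\mathrm{pw}_m(G,A)$ is infinite.
   Context: Let $G$ be a group with generating set $X$. A reduced word $w$ in the alphabet $X^{\pm1}$ is called a palindrome if it reads the same left-to-right and right-to-left. An element $g\in G$ is called a palindrome if there exists a word in $X^{\pm1}$ representing $g$ that is a palindrome. For an integer $m\ge 0$, an element $g\in G$ is an $m$-almost palindrome if some word in $X^{\pm1}$ representing $g$ differs from a palindrome by a change of at most $m$ letters in $X^{\pm1}$. $\mathcal{P}_m(X)$ denotes the set of all $m$-almost palindromes in $G$; in particular $\mathcal{P}_0(X)$ is the set of all palindromes. The $m$-almost palindromic length $l_{\mathcal{P}_m}(g)$ of $g\in G$ is the minimum $k$ such that $g=p_1p_2\cdots p_k$ with each $p_i\in\mathcal{P}_m(X)$. The $m$-almost palindromic width of $G$ with respect to $X$ is $\mathrm{pw}_m(G,X)=\sup_{g\in G} l_{\mathcal{P}_m}(g)$. A function $f:G\to\mathbb{R}$ is a quasimorphism if there is $D\ge 0$ such that $|f(gh)-f(g)-f(h)|\le D$ for all $g,h\in G$. *)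

theory Defs
  imports Complex_Main "HOL-Algebra.Generated_Groups" "HOL-Library.Extended_Nat"
begin

text \<open>
  Letters of the alphabet \<open>X\<^sup>\<plusminus>\<^sup>1\<close> are formal: \<open>(x, True)\<close> stands for \<open>x\<close> and \<open>(x, False)\<close> for
  its formal inverse, so the two letters are distinct even if \<open>x\<close> is an involution of the group.
\<close>

type_synonym 'a letter = "'a \<times> bool"

definition signed_words :: "'a set \<Rightarrow> 'a letter list set" where
  "signed_words X = lists (X \<times> UNIV)"

definition inv_letter :: "'a letter \<Rightarrow> 'a letter" where
  "inv_letter l = (fst l, \<not> snd l)"

definition reduced :: "'a letter list \<Rightarrow> bool" where
  "reduced w \<longleftrightarrow> successively (\<lambda>k l. l \<noteq> inv_letter k) w"

definition palindrome_words :: "'a set \<Rightarrow> 'a letter list set" where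
  "palindrome_words X = {w \<in> signed_words X. reduced w \<and> rev w = w}"

definition letter_val :: "('a, 'b) monoid_scheme \<Rightarrow> 'a letter \<Rightarrow> 'a" where
  "letter_val G l = (if snd l then fst l else inv\<^bsub>G\<^esub> (fst l))"

definition list_mult :: "('a, 'b) monoid_scheme \<Rightarrow> 'a list \<Rightarrow> 'a" where
  "list_mult G gs = foldr (\<otimes>\<^bsub>G\<^esub>) gs \<one>\<^bsub>G\<^esub>"

definition word_val :: "('a, 'b) monoid_scheme \<Rightarrow> 'a letter list \<Rightarrow> 'a" where
  "word_val G w = list_mult G (map (letter_val G) w)"

text \<open>
  Changing letters means substituting letters in place. The word \<open>w\<close> obtained from the
  palindrome \<open>p\<close> need be neither reduced nor a palindrome.
\<close>

definition differ_at_most :: "nat \<Rightarrow> 'l list \<Rightarrow> 'l list \<Rightarrow> bool" where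
  "differ_at_most m w p \<longleftrightarrow>
     length w = length p \<and> card {i. i < length w \<and> w ! i \<noteq> p ! i} \<le> m"

definition almost_palindromes :: "nat \<Rightarrow> ('a, 'b) monoid_scheme \<Rightarrow> 'a set \<Rightarrow> 'a set" where
  "almost_palindromes m G X =
     {word_val G w | w. w \<in> signed_words X \<and> (\<exists>p \<in> palindrome_words X. differ_at_most m w p)}"

lemma almost_palindromes_0:
  "almost_palindromes 0 G X = {word_val G w | w. w \<in> palindrome_words X}"
proof -
  have "differ_at_most 0 w p \<longleftrightarrow> w = p" for w p :: "'a letter list"
    by (auto simp: differ_at_most_def list_eq_iff_nth_eq)
  then show ?thesis
    by (auto simp: almost_palindromes_def palindrome_words_def)
qed

text \<open>The infimum is a minimum whenever \<open>g\<close> is a product of \<open>m\<close>-almost palindromes.\<close>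

definition almost_palindromic_length ::
  "nat \<Rightarrow> ('a, 'b) monoid_scheme \<Rightarrow> 'a set \<Rightarrow> 'a \<Rightarrow> enat" where
  "almost_palindromic_length m G X g =
     Inf {enat (length ps) | ps. ps \<in> lists (almost_palindromes m G X) \<and> g = list_mult G ps}"

definition almost_palindromic_width ::
  "nat \<Rightarrow> ('a, 'b) monoid_scheme \<Rightarrow> 'a set \<Rightarrow> enat" where
  "almost_palindromic_width m G X = (SUP g \<in> carrier G. almost_palindromic_length m G X g)"

definition quasimorphism :: "('a, 'b) monoid_scheme \<Rightarrow> ('a \<Rightarrow> real) \<Rightarrow> bool" where
  "quasimorphism G f \<longleftrightarrow>
     (\<exists>D \<ge> 0. \<forall>g \<in> carrier G. \<forall>h \<in> carrier G. \<bar>f (g \<otimes>\<^bsub>G\<^esub> h) - f g - f h\<bar> \<le> D)"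

end

theory Submission imports Defs begin

text \<open>
  Every letter and its inverse are palindromes, so \<open>f\<close> is bounded above on both and hence, being a
  quasimorphism, bounded in absolute value on letters. Changing one letter of a word therefore
  changes \<open>f\<close> by a bounded amount, so \<open>f\<close> is bounded above on \<open>m\<close>-almost palindromes, and then on
  products of at most \<open>n\<close> of them. If the width were finite, \<open>f\<close> would be bounded above on \<open>G\<close>, and
  applying this to inverses bounds it below as well.
\<close>

lemma quasimorphismE:
  assumes "quasimorphism G f"
  obtains D where "D \<ge> 0"
    "\<And>g h. \<lbrakk>g \<in> carrier G; h \<in> carrier G\<rbrakk> \<Longrightarrow> \<bar>f (g \<otimes>\<^bsub>G\<^esub> h) - f g - f h\<bar> \<le> D"
  using assms unfolding quasimorphism_def by blast

context group
begin

lemma list_mult_closed: "gs \<in> lists (carrier G) \<Longrightarrow> list_mult G gs \<in> carrier G"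
  by (induction gs) (auto simp: list_mult_def)

lemma list_mult_append:
  "\<lbrakk>gs \<in> lists (carrier G); hs \<in> lists (carrier G)\<rbrakk>
    \<Longrightarrow> list_mult G (gs @ hs) = list_mult G gs \<otimes> list_mult G hs"
proof (induction gs)
  case (Cons g gs)
  then show ?case
    using list_mult_closed[of gs] list_mult_closed[of hs] by (auto simp: list_mult_def m_assoc)
qed (use list_mult_closed in \<open>auto simp: list_mult_def\<close>)

lemma letter_val_closed: "\<lbrakk>A \<subseteq> carrier G; l \<in> A \<times> UNIV\<rbrakk> \<Longrightarrow> letter_val G l \<in> carrier G"
  by (auto simp: letter_val_def)

lemma map_letter_val_closed:
  "\<lbrakk>A \<subseteq> carrier G; w \<in> signed_words A\<rbrakk> \<Longrightarrow> map (letter_val G) w \<in> lists (carrier G)"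
  using letter_val_closed by (fastforce simp: signed_words_def in_lists_conv_set)

lemma word_val_closed: "\<lbrakk>A \<subseteq> carrier G; w \<in> signed_words A\<rbrakk> \<Longrightarrow> word_val G w \<in> carrier G"
  unfolding word_val_def by (intro list_mult_closed map_letter_val_closed)

lemma word_val_append:
  "\<lbrakk>A \<subseteq> carrier G; v \<in> signed_words A; w \<in> signed_words A\<rbrakk>
    \<Longrightarrow> word_val G (v @ w) = word_val G v \<otimes> word_val G w"
  by (simp add: word_val_def list_mult_append map_letter_val_closed)

lemma word_val_Cons: "word_val G (l # w) = letter_val G l \<otimes> word_val G w"
  by (simp add: word_val_def list_mult_def)

lemma almost_palindromes_subset_carrier:
  "A \<subseteq> carrier G \<Longrightarrow> almost_palindromes m G A \<subseteq> carrier G"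
  using word_val_closed by (auto simp: almost_palindromes_def)

text \<open>A one-letter word is reduced and equal to its reversal whichever sign the letter
  carries, so a bound on palindromes applies to a generator and to its inverse alike.\<close>

lemma letter_val_palindrome:
  assumes "A \<subseteq> carrier G" "l \<in> A \<times> UNIV"
  shows "letter_val G l \<in> almost_palindromes 0 G A"
proof -
  have "word_val G [l] = letter_val G l"
    using letter_val_closed[OF assms] by (simp add: word_val_def list_mult_def)
  moreover have "[l] \<in> palindrome_words A"
    using assms by (auto simp: palindrome_words_def signed_words_def reduced_def)
  ultimately show ?thesis
    unfolding almost_palindromes_0 by (metis (mono_tags, lifting) mem_Collect_eq)
qed

text \<open>Since \<open>f g + f (inv g)\<close> is within the defect of \<open>f \<one>\<close>, an
  upper bound at \<open>inv g\<close> is a lower bound at \<open>g\<close>. The set \<open>S\<close>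
  is left general because the argument serves both the values of letters and the whole
  group.\<close>

lemma quasimorphism_bounded_if_bounded_above:
  assumes "quasimorphism G f" and "\<And>g. g \<in> S \<Longrightarrow> f g \<le> c"
    and "S \<subseteq> carrier G" and "\<And>g. g \<in> S \<Longrightarrow> inv g \<in> S"
  shows "\<exists>B\<ge>0. \<forall>g\<in>S. \<bar>f g\<bar> \<le> B"
proof -
  obtain D where D: "D \<ge> 0"
    "\<And>g h. \<lbrakk>g \<in> carrier G; h \<in> carrier G\<rbrakk> \<Longrightarrow> \<bar>f (g \<otimes> h) - f g - f h\<bar> \<le> D"
    using assms(1) by (rule quasimorphismE) blast
  have "\<bar>f g\<bar> \<le> \<bar>f \<one>\<bar> + D + \<bar>c\<bar>" if "g \<in> S" for g
  proof -
    have g: "g \<in> carrier G"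
      using assms(3) that by blast
    have "\<bar>f \<one> - f g - f (inv g)\<bar> \<le> D"
      using D(2)[OF g inv_closed[OF g]] g by simp
    with assms(2)[OF that] assms(2)[OF assms(4)[OF that]] \<open>D \<ge> 0\<close> show ?thesis
      by linarith
  qed
  with \<open>D \<ge> 0\<close> show ?thesis
    by (intro exI[of _ "\<bar>f \<one>\<bar> + D + \<bar>c\<bar>"]) auto
qed

lemma quasimorphism_bounded_on_letters:
  assumes "quasimorphism G f" and "A \<subseteq> carrier G"
    and "\<And>p. p \<in> almost_palindromes 0 G A \<Longrightarrow> f p \<le> c"
  shows "\<exists>L\<ge>0. \<forall>l\<in>A \<times> UNIV. \<bar>f (letter_val G l)\<bar> \<le> L"
proof -
  \<comment> \<open>The set of letter values is closed under inversion, since flipping the sign of a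
    letter inverts its value.\<close>
  have "inv (letter_val G l) \<in> letter_val G ` (A \<times> UNIV)" if "l \<in> A \<times> UNIV" for l
  proof -
    have "inv (letter_val G l) = letter_val G (inv_letter l)"
      using that assms(2) by (auto simp: letter_val_def inv_letter_def)
    moreover have "inv_letter l \<in> A \<times> UNIV"
      using that by (auto simp: inv_letter_def)
    ultimately show ?thesis by (metis image_eqI)
  qed
  then have "\<exists>L\<ge>0. \<forall>g\<in>letter_val G ` (A \<times> UNIV). \<bar>f g\<bar> \<le> L"
    using assms(2,3) letter_val_palindrome letter_val_closed
    by (intro quasimorphism_bounded_if_bounded_above[OF assms(1), of _ c]) (blast | fastforce)+
  then show ?thesis by blast
qed

text \<open>Both words have the form \<open>u l v\<close> with the same \<open>u\<close> and
  \<open>v\<close>, and \<open>f\<close> of such a product is close to \<open>f u + f v\<close> for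
  every letter \<open>l\<close>.\<close>

lemma quasimorphism_change_letter:
  fixes f :: "'a \<Rightarrow> real"
  assumes D: "\<And>g h. \<lbrakk>g \<in> carrier G; h \<in> carrier G\<rbrakk> \<Longrightarrow> \<bar>f (g \<otimes> h) - f g - f h\<bar> \<le> D"
    and A: "A \<subseteq> carrier G" and L: "\<And>l. l \<in> A \<times> UNIV \<Longrightarrow> \<bar>f (letter_val G l)\<bar> \<le> L"
    and w: "w \<in> signed_words A" and k: "k \<in> A \<times> UNIV" and i: "i < length w"
  shows "f (word_val G w) \<le> f (word_val G (w[i := k])) + (4 * D + 2 * L)"
proof -
  let ?u = "word_val G (take i w)" and ?v = "word_val G (drop (Suc i) w)"
  have tw: "take i w \<in> signed_words A" and dw: "drop (Suc i) w \<in> signed_words A"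
    and wi: "w ! i \<in> A \<times> UNIV"
    using w i by (auto simp: signed_words_def in_lists_conv_set dest: in_set_takeD in_set_dropD)
  \<comment> \<open>Two splittings, \<open>u\<close> from \<open>l v\<close> and then
    \<open>l\<close> from \<open>v\<close>, cost \<open>D\<close> each, and dropping
    \<open>f l\<close> costs \<open>L\<close>. Using this for the old and for the new letter doubles
    the constant.\<close>
  have *: "\<bar>f (word_val G (take i w @ l # drop (Suc i) w)) - f ?u - f ?v\<bar> \<le> 2 * D + L"
    if l: "l \<in> A \<times> UNIV" for l
  proof -
    have "l # drop (Suc i) w \<in> signed_words A"
      using dw l by (simp add: signed_words_def)
    then have "word_val G (take i w @ l # drop (Suc i) w) = ?u \<otimes> (letter_val G l \<otimes> ?v)"
      using word_val_append[OF A tw] by (simp add: word_val_Cons)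
    moreover note clo = word_val_closed[OF A tw] word_val_closed[OF A dw] letter_val_closed[OF A l]
    ultimately show ?thesis
      using D[of ?u "letter_val G l \<otimes> ?v"] D[of "letter_val G l" ?v] L[OF l] m_closed[OF clo(3,2)]
      by (smt (verit))
  qed
  show ?thesis
    using *[OF wi] *[OF k] i by (simp add: id_take_nth_drop[symmetric] upd_conv_take_nth_drop)
qed

text \<open>Induction on \<open>m\<close> with \<open>p\<close> fixed: each step restores the letter
  of \<open>p\<close> at one position where \<open>w\<close> disagrees with it.\<close>

lemma quasimorphism_change_letters:
  fixes f :: "'a \<Rightarrow> real"
  assumes D: "\<And>g h. \<lbrakk>g \<in> carrier G; h \<in> carrier G\<rbrakk> \<Longrightarrow> \<bar>f (g \<otimes> h) - f g - f h\<bar> \<le> D"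
    and A: "A \<subseteq> carrier G" and L: "\<And>l. l \<in> A \<times> UNIV \<Longrightarrow> \<bar>f (letter_val G l)\<bar> \<le> L"
    and nonneg: "D \<ge> 0" "L \<ge> 0"
    and "w \<in> signed_words A" "p \<in> signed_words A" "differ_at_most m w p"
  shows "f (word_val G w) \<le> f (word_val G p) + real m * (4 * D + 2 * L)"
  using assms(6-8)
proof (induction m arbitrary: w)
  case 0
  then have "w = p"
    by (auto simp: differ_at_most_def list_eq_iff_nth_eq)
  then show ?case by simp
next
  case (Suc m)
  show ?case
  proof (cases "w = p")
    case True
    with nonneg show ?thesis by simp
  next
    case False
    have len: "length w = length p"
      using Suc.prems by (simp add: differ_at_most_def)
    with False obtain i where i: "i < length w" "w ! i \<noteq> p ! i"
      by (auto simp: list_eq_iff_nth_eq)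
    have pi: "p ! i \<in> A \<times> UNIV"
      using Suc.prems(2) i(1) len by (auto simp: signed_words_def in_lists_conv_set)
    let ?w = "w[i := p ! i]"
    let ?d = "{j. j < length w \<and> w ! j \<noteq> p ! j}"
    \<comment> \<open>The restored letter removes \<open>i\<close> from the disagreements and
      creates no new one, so their number drops by exactly one.\<close>
    have "{j. j < length ?w \<and> ?w ! j \<noteq> p ! j} = ?d - {i}"
      using i by (auto simp: nth_list_update split: if_splits)
    moreover have "card (?d - {i}) = card ?d - 1"
      using i by (intro card_Diff_singleton) simp
    moreover have "card ?d \<le> Suc m"
      using Suc.prems(3) unfolding differ_at_most_def by blast
    ultimately have "differ_at_most m ?w p"
      unfolding differ_at_most_def using len by (metis (lifting) diff_Suc_1 diff_le_mono length_list_update)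
    moreover have "?w \<in> signed_words A"
      using Suc.prems(1) pi set_update_subset_insert[of w i "p ! i"]
      by (auto simp: signed_words_def in_lists_conv_set)
    ultimately have "f (word_val G ?w) \<le> f (word_val G p) + real m * (4 * D + 2 * L)"
      using Suc.IH Suc.prems(2) by blast
    with quasimorphism_change_letter[OF D A L Suc.prems(1) pi i(1)] show ?thesis
      by (simp add: algebra_simps)
  qed
qed

lemma quasimorphism_bounded_above_on_almost_palindromes:
  assumes "quasimorphism G f" and A: "A \<subseteq> carrier G"
    and c: "\<And>p. p \<in> almost_palindromes 0 G A \<Longrightarrow> f p \<le> c"
  shows "\<exists>C. \<forall>p\<in>almost_palindromes m G A. f p \<le> C"
proof -
  obtain D where D: "D \<ge> 0"
    "\<And>g h. \<lbrakk>g \<in> carrier G; h \<in> carrier G\<rbrakk> \<Longrightarrow> \<bar>f (g \<otimes> h) - f g - f h\<bar> \<le> D"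
    using assms(1) by (rule quasimorphismE) blast
  obtain L where L: "L \<ge> 0" "\<And>l. l \<in> A \<times> UNIV \<Longrightarrow> \<bar>f (letter_val G l)\<bar> \<le> L"
    using quasimorphism_bounded_on_letters[OF assms] by blast
  have "f (word_val G w) \<le> c + real m * (4 * D + 2 * L)"
    if "w \<in> signed_words A" "p \<in> palindrome_words A" "differ_at_most m w p" for w p
  proof -
    have "p \<in> signed_words A" "f (word_val G p) \<le> c"
      using that(2) c by (auto simp: palindrome_words_def almost_palindromes_0)
    with quasimorphism_change_letters[OF D(2) A L(2) D(1) L(1) that(1) _ that(3)]
    show ?thesis by fastforce
  qed
  then show ?thesis
    unfolding almost_palindromes_def by blast
qed

text \<open>Splitting off the first factor adds at most its own value \<open>C\<close> and one
  defect \<open>D\<close>; the empty product leaves \<open>f \<one>\<close>.\<close>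

lemma quasimorphism_list_mult_le:
  fixes f :: "'a \<Rightarrow> real"
  assumes D: "\<And>g h. \<lbrakk>g \<in> carrier G; h \<in> carrier G\<rbrakk> \<Longrightarrow> \<bar>f (g \<otimes> h) - f g - f h\<bar> \<le> D"
    and S: "S \<subseteq> carrier G" "\<And>g. g \<in> S \<Longrightarrow> f g \<le> C" and "gs \<in> lists S"
  shows "f (list_mult G gs) \<le> f \<one> + real (length gs) * (C + D)"
  using assms(4)
proof (induction gs)
  case (Cons g gs)
  have "gs \<in> lists (carrier G)"
    using Cons.hyps S(1) by blast
  then have "\<bar>f (g \<otimes> list_mult G gs) - f g - f (list_mult G gs)\<bar> \<le> D"
    using D Cons.hyps S(1) list_mult_closed by blast
  then show ?case
    using Cons.IH S(2)[OF Cons.hyps(1)] by (simp add: list_mult_def algebra_simps)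
qed (simp add: list_mult_def)

end

text \<open>The infimum of the empty set in \<open>enat\<close> is \<open>\<infinity>\<close>, so a
  finite width guarantees that factorisations exist as well as bounding their length
  uniformly.\<close>

lemma almost_palindromic_width_finite_imp_factorisation:
  assumes "almost_palindromic_width m G A \<noteq> \<infinity>"
  obtains n where "\<And>g. g \<in> carrier G \<Longrightarrow>
    \<exists>ps \<in> lists (almost_palindromes m G A). g = list_mult G ps \<and> length ps \<le> n"
proof -
  obtain n where n: "almost_palindromic_width m G A = enat n"
    using assms by auto
  have "\<exists>ps \<in> lists (almost_palindromes m G A). g = list_mult G ps \<and> length ps \<le> n"
    if "g \<in> carrier G" for g
  proof -
    have "almost_palindromic_length m G A g \<le> enat n"
      using that unfolding n[symmetric] almost_palindromic_width_def by (rule SUP_upper)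
    \<comment> \<open>A strict bound on an infimum yields a member below it, and a length below
      \<open>Suc n\<close> is at most \<open>n\<close>.\<close>
    also have "\<dots> < enat (Suc n)" by simp
    finally show ?thesis
      unfolding almost_palindromic_length_def Inf_less_iff by auto
  qed
  with that show thesis by blast
qed

theorem theorem1p1:
  fixes G :: "('a, 'b) monoid_scheme" and A :: "'a set" and m :: nat
  assumes "group G"
    and "A \<subseteq> carrier G"
    and "generate G A = carrier G"
    and "\<exists>f :: 'a \<Rightarrow> real. quasimorphism G f
           \<and> \<not> (\<exists>B. \<forall>g \<in> carrier G. \<bar>f g\<bar> \<le> B)
           \<and> (\<exists>c. \<forall>p \<in> almost_palindromes 0 G A. f p \<le> c)"
  shows "almost_palindromic_width m G A = \<infinity>"
proof (rule ccontr)
  assume "almost_palindromic_width m G A \<noteq> \<infinity>"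
  then obtain n where n: "\<And>g. g \<in> carrier G \<Longrightarrow>
      \<exists>ps \<in> lists (almost_palindromes m G A). g = list_mult G ps \<and> length ps \<le> n"
    by (rule almost_palindromic_width_finite_imp_factorisation) blast
  interpret group G by fact
  obtain f :: "'a \<Rightarrow> real" and c where f: "quasimorphism G f"
    and unbounded: "\<not> (\<exists>B. \<forall>g \<in> carrier G. \<bar>f g\<bar> \<le> B)"
    and c: "\<And>p. p \<in> almost_palindromes 0 G A \<Longrightarrow> f p \<le> c"
    using assms(4) by blast
  obtain D where D: "D \<ge> 0"
    "\<And>g h. \<lbrakk>g \<in> carrier G; h \<in> carrier G\<rbrakk> \<Longrightarrow> \<bar>f (g \<otimes>\<^bsub>G\<^esub> h) - f g - f h\<bar> \<le> D"
    using f by (rule quasimorphismE) blast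
  obtain C where C: "\<And>p. p \<in> almost_palindromes m G A \<Longrightarrow> f p \<le> C"
    using quasimorphism_bounded_above_on_almost_palindromes[OF f assms(2) c] by blast
  \<comment> \<open>\<open>C\<close> may be negative; with \<open>\<bar>C\<bar>\<close> the cost per
    factor is nonnegative, so the estimate for \<open>length ps\<close> factors increases to the one
    for \<open>n\<close>.\<close>
  have "f g \<le> f \<one>\<^bsub>G\<^esub> + real n * (\<bar>C\<bar> + D)" if "g \<in> carrier G" for g
  proof -
    obtain ps where ps: "ps \<in> lists (almost_palindromes m G A)" "g = list_mult G ps"
      "length ps \<le> n"
      using n \<open>g \<in> carrier G\<close> by blast
    have "f p \<le> \<bar>C\<bar>" if "p \<in> almost_palindromes m G A" for p
      using C[OF that] by linarith
    then have "f g \<le> f \<one>\<^bsub>G\<^esub> + real (length ps) * (\<bar>C\<bar> + D)"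
      unfolding ps(2)
      using quasimorphism_list_mult_le[of f D, OF D(2) almost_palindromes_subset_carrier[OF assms(2)] _ ps(1)]
      by blast
    also have "\<dots> \<le> f \<one>\<^bsub>G\<^esub> + real n * (\<bar>C\<bar> + D)"
      using ps(3) D(1) by (intro add_left_mono mult_right_mono) auto
    finally show ?thesis .
  qed
  then have "\<exists>B\<ge>0. \<forall>g\<in>carrier G. \<bar>f g\<bar> \<le> B"
    by (intro quasimorphism_bounded_if_bounded_above[OF f]) auto
  with unbounded show False by blast
qed

end
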